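(* Let $\alpha>0$, let $G$ be a weighted multigraph and let $i,j$ be two vertices of $G$. The forest distance $d_{ij}$ is equal to the probability of choosing an unsuccessful connection between $i$ and $j$ in the following model of connecting $i$ and $j$: (1) Choose one of the two vertices, $i$ or $j$, with probability $1/2$ each. (2) Choose a spanning rooted forest of $G_\alpha$ at random (independently of step (1)), the probability of choosing the forest $F$ being $$p(F)=\frac{\varepsilon(F)}{\sum_{F'\in\mathcal F(G_\alpha)}\varepsilon(F')}.$$ (3) If the forest chosen in step (2) is an unsuccessful connection from the vertex chosen in step (1) to the remaining vertex of the pair $(i,j)$, then we say that an unsuccessful connection between $i$ and $j$ is chosen.
   Context: A weighted multigraph $G$ has finite vertex set $V(G)=\{1,\ldots,n\}$; multiple edges are allowed, loops are not, and all edge weights are strictly positive. Its Laplacian matrix $L=L(G)=(\ell_{ij})$ is given by: for $j\ne i$, $\ell_{ij}$ is minus the sum of the weights of all edges with terminal vertices $i$ and $j$; and $\ell_{ii}=-\sum_{j\neq i}\ell_{ij}$. For a fixed parameter $\alpha>0$, the relative forest accessibility matrix is $Q=(q_{ij})=(I+\alpha L)^{-1}$, and the forest distance is $d_{ij}=\frac12(q_{ii}+q_{jj}-q_{ij}-q_{ji})$. $G_\alpha$ denotes the weighted multigraph obtained from $G$ by multiplying the weights of all its edges by $\alpha$. A rooted forest is an acyclic graph with one vertex marked as a root in each of its components; the components are rooted trees (a single vertex is allowed as a tree). $\mathcal F(G_\alpha)$ is the set of all spanning rooted forests of $G_\alpha$, i.e. rooted forests that are subgraphs of $G_\alpha$ with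 vertex set all of $V(G)$ (parallel edges are regarded as distinct). The weight $\varepsilon(F)$ of a forest $F$ is the product of the weights of its edges (in $G_\alpha$), the empty product being $1$. An unsuccessful connection from $i$ to $j$ is a spanning rooted forest in which $i$ is a root of a tree and $j$ does not belong to this tree. *)

theory Defs
  imports "HOL-Analysis.Analysis" "HOL-Probability.Probability"
begin

section \<open>Weighted multigraphs\<close>

text \<open>
  The vertex set is the whole finite type \<open>'v\<close>. Edges are abstract names of type \<open>'e\<close>, so that
  parallel edges are distinct objects; an edge is undirected, \<open>ends G e\<close> being the set of its two
  end vertices.
\<close>

record ('v, 'e) multigraph =
  edges :: "'e set"
  ends :: "'e \<Rightarrow> 'v set"
  weight :: "'e \<Rightarrow> real"

locale weighted_multigraph =
  fixes G :: "('v::finite, 'e) multigraph"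
  assumes finite_edges: "finite (edges G)"
    and no_loops: "e \<in> edges G \<Longrightarrow> card (ends G e) = 2"
    and weight_pos: "e \<in> edges G \<Longrightarrow> weight G e > 0"

definition scale_weights :: "real \<Rightarrow> ('v, 'e) multigraph \<Rightarrow> ('v, 'e) multigraph" where
  "scale_weights \<alpha> G = G\<lparr>weight := \<lambda>e. \<alpha> * weight G e\<rparr>"

section \<open>Laplacian matrix and forest distance\<close>

definition lap_off :: "('v::finite, 'e) multigraph \<Rightarrow> 'v \<Rightarrow> 'v \<Rightarrow> real" where
  "lap_off G i j = - (\<Sum>e | e \<in> edges G \<and> ends G e = {i, j}. weight G e)"

definition laplacian :: "('v::finite, 'e) multigraph \<Rightarrow> real ^ 'v ^ 'v" where
  "laplacian G = (\<chi> i j. if j \<noteq> i then lap_off G i j else - (\<Sum>k\<in>UNIV - {i}. lap_off G i k))"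

definition forest_accessibility :: "real \<Rightarrow> ('v::finite, 'e) multigraph \<Rightarrow> real ^ 'v ^ 'v" where
  "forest_accessibility \<alpha> G = matrix_inv (mat 1 + \<alpha> *\<^sub>R laplacian G)"

definition forest_dist :: "real \<Rightarrow> ('v::finite, 'e) multigraph \<Rightarrow> 'v \<Rightarrow> 'v \<Rightarrow> real" where
  "forest_dist \<alpha> G i j =
     (let Q = forest_accessibility \<alpha> G in 1/2 * (Q $ i $ i + Q $ j $ j - Q $ i $ j - Q $ j $ i))"

section \<open>Spanning rooted forests\<close>

text \<open>
  A spanning subgraph of \<open>G\<close> is given by its edge set \<open>A \<subseteq> edges G\<close>. In a multigraph two parallel
  edges form a cycle of length 2.
\<close>

definition is_cycle :: "('v, 'e) multigraph \<Rightarrow> 'v list \<Rightarrow> 'e list \<Rightarrow> bool" where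
  "is_cycle G vs es \<longleftrightarrow>
     es \<noteq> [] \<and> length vs = length es \<and> distinct vs \<and> distinct es \<and>
     (\<forall>k < length es. ends G (es ! k) = {vs ! k, vs ! (Suc k mod length es)})"

definition acyclic_edges :: "('v, 'e) multigraph \<Rightarrow> 'e set \<Rightarrow> bool" where
  "acyclic_edges G A \<longleftrightarrow> (\<nexists>vs es. is_cycle G vs es \<and> set es \<subseteq> A)"

definition connection :: "('v, 'e) multigraph \<Rightarrow> 'e set \<Rightarrow> 'v rel" where
  "connection G A = {(u, v). \<exists>e\<in>A. ends G e = {u, v}}\<^sup>*"

definition graph_components :: "('v, 'e) multigraph \<Rightarrow> 'e set \<Rightarrow> 'v set set" where
  "graph_components G A = UNIV // connection G A"

text \<open>A spanning rooted forest is a pair of its edge set and its set of roots.\<close>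

definition spanning_rooted_forests :: "('v, 'e) multigraph \<Rightarrow> ('e set \<times> 'v set) set" where
  "spanning_rooted_forests G =
     {(A, R). A \<subseteq> edges G \<and> acyclic_edges G A \<and>
        (\<forall>C \<in> graph_components G A. \<exists>!r. r \<in> C \<and> r \<in> R)}"

definition forest_weight :: "('v, 'e) multigraph \<Rightarrow> 'e set \<times> 'v set \<Rightarrow> real" where
  "forest_weight G F = (\<Prod>e\<in>fst F. weight G e)"

definition unsuccessful_connection ::
    "('v, 'e) multigraph \<Rightarrow> 'v \<Rightarrow> 'v \<Rightarrow> 'e set \<times> 'v set \<Rightarrow> bool" where
  "unsuccessful_connection G i j F \<longleftrightarrow>
     F \<in> spanning_rooted_forests G \<and> i \<in> snd F \<and>
     (\<exists>C \<in> graph_components G (fst F). i \<in> C \<and> j \<notin> C)"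

section \<open>The random connection model\<close>

definition forest_prob :: "('v, 'e) multigraph \<Rightarrow> 'e set \<times> 'v set \<Rightarrow> real" where
  "forest_prob G F =
     (if F \<in> spanning_rooted_forests G
      then forest_weight G F / (\<Sum>F'\<in>spanning_rooted_forests G. forest_weight G F') else 0)"

definition random_forest :: "('v, 'e) multigraph \<Rightarrow> ('e set \<times> 'v set) pmf" where
  "random_forest G = embed_pmf (forest_prob G)"

text \<open>The coin shows \<open>True\<close> if \<open>i\<close> is the vertex chosen, and \<open>False\<close> if it is \<open>j\<close>.\<close>

definition connection_model ::
    "real \<Rightarrow> ('v, 'e) multigraph \<Rightarrow> (bool \<times> ('e set \<times> 'v set)) pmf" where
  "connection_model \<alpha> G = pair_pmf (bernoulli_pmf (1/2)) (random_forest (scale_weights \<alpha> G))"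

definition unsuccessful_event ::
    "real \<Rightarrow> ('v, 'e) multigraph \<Rightarrow> 'v \<Rightarrow> 'v \<Rightarrow> (bool \<times> ('e set \<times> 'v set)) set" where
  "unsuccessful_event \<alpha> G i j =
     {(c, F). if c then unsuccessful_connection (scale_weights \<alpha> G) i j F
              else unsuccessful_connection (scale_weights \<alpha> G) j i F}"

section \<open>Well-definedness\<close>

text \<open>
  \<^const>\<open>embed_pmf\<close> and \<^const>\<open>matrix_inv\<close> are unspecified outside their intended domain; the
  following lemmas show that they are only used inside it.
\<close>

lemma weighted_multigraph_scale:
  assumes "weighted_multigraph G" "\<alpha> > 0"
  shows "weighted_multigraph (scale_weights \<alpha> G)"
  using assms by (auto simp: weighted_multigraph_def scale_weights_def)

lemma empty_forest: "({}, UNIV) \<in> spanning_rooted_forests G"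
  by (auto simp: spanning_rooted_forests_def acyclic_edges_def is_cycle_def graph_components_def
      connection_def quotient_def)

context weighted_multigraph
begin

lemma finite_forests: "finite (spanning_rooted_forests G)"
  by (rule finite_subset[of _ "Pow (edges G) \<times> UNIV"])
     (auto simp: spanning_rooted_forests_def finite_edges)

lemma forest_weight_pos: "F \<in> spanning_rooted_forests G \<Longrightarrow> forest_weight G F > 0"
  by (auto simp: spanning_rooted_forests_def forest_weight_def intro!: prod_pos weight_pos)

lemma total_forest_weight_pos: "(\<Sum>F\<in>spanning_rooted_forests G. forest_weight G F) > 0"
  using empty_forest[of G] by (intro sum_pos finite_forests forest_weight_pos) auto

lemma pmf_random_forest: "pmf (random_forest G) F = forest_prob G F"
  unfolding random_forest_def
proof (rule pmf_embed_pmf)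
  let ?S = "spanning_rooted_forests G"
  show nonneg: "0 \<le> forest_prob G F" for F
    using total_forest_weight_pos forest_weight_pos[of F]
    by (auto simp: forest_prob_def intro!: divide_nonneg_pos)
  have "(\<integral>\<^sup>+F. ennreal (forest_prob G F) \<partial>count_space UNIV) = (\<Sum>F\<in>?S. ennreal (forest_prob G F))"
    by (rule nn_integral_count_space') (auto simp: finite_forests forest_prob_def)
  also have "\<dots> = ennreal (\<Sum>F\<in>?S. forest_prob G F)"
    using nonneg by simp
  also have "(\<Sum>F\<in>?S. forest_prob G F) = 1"
    using total_forest_weight_pos by (simp add: forest_prob_def flip: sum_divide_distrib)
  finally show "(\<integral>\<^sup>+F. ennreal (forest_prob G F) \<partial>count_space UNIV) = 1"
    by simp
qed

lemma invertible_id_plus_laplacian: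
  assumes "\<alpha> > 0"
  shows "invertible (mat 1 + \<alpha> *\<^sub>R laplacian G)"
proof -
  let ?M = "mat 1 + \<alpha> *\<^sub>R laplacian G"
  have off: "lap_off G i j \<le> 0" for i j
    using weight_pos by (auto simp: lap_off_def less_imp_le intro!: sum_nonneg)
  have "x = 0" if x: "?M *v x = 0" for x :: "real ^ 'v"
  proof -
    obtain m where m: "\<And>j. \<bar>x $ j\<bar> \<le> \<bar>x $ m\<bar>"
    proof -
      have "Max (range (\<lambda>j. \<bar>x $ j\<bar>)) \<in> range (\<lambda>j. \<bar>x $ j\<bar>)"
        by (rule Max_in) auto
      then obtain m where "Max (range (\<lambda>j. \<bar>x $ j\<bar>)) = \<bar>x $ m\<bar>" by blast
      then show ?thesis by (intro that[of m]) (metis Max_ge finite finite_imageI rangeI)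
    qed
    define S where "S = (\<Sum>k\<in>UNIV - {m}. lap_off G m k)"
    have "0 = (?M *v x) $ m" using x by simp
    also have "\<dots> = (\<Sum>j\<in>UNIV. ?M $ m $ j * x $ j)"
      by (simp add: matrix_vector_mult_def)
    also have "\<dots> = ?M $ m $ m * x $ m + (\<Sum>j\<in>UNIV - {m}. ?M $ m $ j * x $ j)"
      by (rule sum.remove) auto
    also have "?M $ m $ m = 1 - \<alpha> * S"
      by (simp add: mat_def laplacian_def S_def)
    also have "(\<Sum>j\<in>UNIV - {m}. ?M $ m $ j * x $ j) = (\<Sum>j\<in>UNIV - {m}. \<alpha> * lap_off G m j * x $ j)"
      by (rule sum.cong) (auto simp: mat_def laplacian_def)
    finally have eq: "(1 - \<alpha> * S) * x $ m = - (\<Sum>j\<in>UNIV - {m}. \<alpha> * lap_off G m j * x $ j)"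
      by linarith
    have S: "S \<le> 0" unfolding S_def by (rule sum_nonpos) (use off in auto)
    then have "\<alpha> * S \<le> 0" using assms by (simp add: mult_nonneg_nonpos)
    then have "(1 - \<alpha> * S) * \<bar>x $ m\<bar> = \<bar>(1 - \<alpha> * S) * x $ m\<bar>"
      by (simp add: abs_mult)
    also have "\<dots> \<le> (\<Sum>j\<in>UNIV - {m}. \<bar>\<alpha> * lap_off G m j * x $ j\<bar>)"
      unfolding eq by (simp only: abs_minus_cancel) (rule sum_abs)
    also have "\<dots> \<le> (\<Sum>j\<in>UNIV - {m}. - \<alpha> * lap_off G m j * \<bar>x $ m\<bar>)"
    proof (rule sum_mono)
      fix j
      have "\<bar>\<alpha> * lap_off G m j * x $ j\<bar> = (- \<alpha> * lap_off G m j) * \<bar>x $ j\<bar>"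
        using assms off[of m j] by (simp add: abs_mult)
      also have "\<dots> \<le> (- \<alpha> * lap_off G m j) * \<bar>x $ m\<bar>"
        by (rule mult_left_mono[OF m]) (use assms off[of m j] in \<open>simp add: mult_nonneg_nonpos\<close>)
      finally show "\<bar>\<alpha> * lap_off G m j * x $ j\<bar> \<le> - \<alpha> * lap_off G m j * \<bar>x $ m\<bar>" .
    qed
    also have "\<dots> = - \<alpha> * S * \<bar>x $ m\<bar>"
      by (simp add: S_def sum_distrib_left sum_distrib_right sum_negf mult.assoc)
    finally have "\<bar>x $ m\<bar> \<le> 0" by (simp add: algebra_simps)
    then show "x = 0" using m by (simp add: vec_eq_iff)
  qed
  then show ?thesis
    by (simp add: invertible_left_inverse matrix_left_invertible_ker)
qed

end

end

theory Submission
  imports Defs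
begin

text \<open>
  Both sides reduce to the matrix forest theorem: the inverse of \<open>I + \<alpha> L\<close> has \<open>(i, j)\<close> entry
  \<open>f(i, j) / \<sigma>\<close>, where \<open>\<sigma>\<close> is the total weight of the rooted forests and \<open>f(i, j)\<close> the weight of those
  in which \<open>j\<close> lies in the tree rooted at \<open>i\<close>. No determinants are needed: it suffices to verify
  \<open>f (I + \<alpha> L) = \<sigma> I\<close>. In \<open>f L\<close>, a pair of a forest and an edge contributes only if the edge joins
  two trees, so the pairs can be regrouped by the larger forest \<open>B\<close>. Removing \<open>e\<close> from
  \<open>B\<close> multiplies the number of root choices with \<open>i\<close> a root by the number of vertices \<open>r\<close> which \<open>e\<close>
  separates from \<open>i\<close>. Exchanging the sums over \<open>e\<close> and \<open>r\<close>, the contribution of each \<open>r\<close> is the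
  divergence at \<open>j\<close> of the unit flow along the path of \<open>B\<close> from \<open>i\<close> to \<open>r\<close>.
\<close>

section \<open>Connections\<close>

lemma sym_connection: "sym (connection G A)"
  unfolding connection_def by (rule sym_rtrancl) (auto simp: sym_def insert_commute)

lemma connection_commute: "(x, y) \<in> connection G A \<longleftrightarrow> (y, x) \<in> connection G A"
  using sym_connection[of G A] by (auto simp: sym_def)

lemma connection_refl [simp]: "(x, x) \<in> connection G A"
  by (simp add: connection_def)

lemma connection_trans:
  "(x, y) \<in> connection G A \<Longrightarrow> (y, z) \<in> connection G A \<Longrightarrow> (x, z) \<in> connection G A"
  unfolding connection_def by (rule rtrancl_trans)

lemma connection_edge: "e \<in> A \<Longrightarrow> ends G e = {u, v} \<Longrightarrow> (u, v) \<in> connection G A"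
  unfolding connection_def by (rule r_into_rtrancl) auto

text \<open>A walk from \<open>x\<close> to \<open>y\<close> can be shortened so that it crosses
  \<open>e\<close> at most once; the last two cases are the two directions of the crossing.\<close>

lemma connection_insert:
  assumes "ends G e = {u, v}"
  shows "(x, y) \<in> connection G (insert e A) \<longleftrightarrow>
    (x, y) \<in> connection G A \<or>
    (x, u) \<in> connection G A \<and> (v, y) \<in> connection G A \<or>
    (x, v) \<in> connection G A \<and> (u, y) \<in> connection G A"
proof -
  let ?S = "{(u, v). \<exists>e\<in>A. ends G e = {u, v}}"
  have "{(u, v). \<exists>e\<in>insert e A. ends G e = {u, v}} = insert (u, v) (insert (v, u) ?S)"
    using assms by (auto simp: doubleton_eq_iff)
  then have "connection G (insert e A) = (insert (u, v) (insert (v, u) ?S))\<^sup>*"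
    by (simp add: connection_def)
  then show ?thesis
    using connection_trans[of _ _ G A] connection_commute[of _ _ G A]
    by (simp only: rtrancl_insert flip: connection_def) blast
qed

section \<open>Acyclic edge sets\<close>

lemma acyclic_edges_subset: "acyclic_edges G B \<Longrightarrow> A \<subseteq> B \<Longrightarrow> acyclic_edges G A"
  unfolding acyclic_edges_def by blast

text \<open>Induction along the connection: when the next edge leads back to a vertex of the path,
  the path is cut off at that vertex.\<close>

lemma connection_simple_path:
  assumes "(u, v) \<in> connection G A"
  obtains vs es where "vs \<noteq> []" "hd vs = u" "last vs = v" "distinct vs"
    "length vs = Suc (length es)" "set es \<subseteq> A"
    "\<And>k. k < length es \<Longrightarrow> ends G (es ! k) = {vs ! k, vs ! Suc k}"
proof -
  define path where "path y vs es \<longleftrightarrow> vs \<noteq> [] \<and> hd vs = u \<and> last vs = y \<and> distinct vs \<and>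
    length vs = Suc (length es) \<and> set es \<subseteq> A \<and>
    (\<forall>k < length es. ends G (es ! k) = {vs ! k, vs ! Suc k})" for y vs es
  have "\<exists>vs es. path v vs es"
    using assms unfolding connection_def
  proof (induction rule: rtrancl_induct)
    case base
    have "path u [u] []" by (simp add: path_def)
    then show ?case by blast
  next
    case (step y z)
    then obtain vs es where p: "path y vs es" by blast
    obtain e where e: "e \<in> A" "ends G e = {y, z}" using step by blast
    show ?case
    proof (cases "z \<in> set vs")
      case True
      then obtain m where m: "m < length vs" "vs ! m = z" by (auto simp: in_set_conv_nth)
      have "length (take (Suc m) vs) = Suc m" "length (take m es) = m"
        using p m by (auto simp: path_def)
      then have "path z (take (Suc m) vs) (take m es)"
        using p m set_take_subset[of m es]
        by (auto simp: path_def last_conv_nth hd_conv_nth simp del: length_take)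
      then show ?thesis by blast
    next
      case False
      have "path z (vs @ [z]) (es @ [e])"
        using p e False
        by (auto simp: path_def nth_append last_conv_nth less_Suc_eq insert_commute)
      then show ?thesis by blast
    qed
  qed
  then show thesis using that unfolding path_def by blast
qed

context weighted_multigraph
begin

lemma edge_ends:
  assumes "e \<in> edges G"
  obtains u v where "ends G e = {u, v}" "u \<noteq> v"
  using no_loops[OF assms] by (auto simp: card_2_iff)

text \<open>A simple path from \<open>u\<close> to \<open>v\<close> avoiding \<open>e\<close> would
  close up with \<open>e\<close> to a cycle.\<close>

lemma acyclic_edge_bridge:
  assumes "acyclic_edges G A" "A \<subseteq> edges G" "e \<in> A" "ends G e = {u, v}"
  shows "(u, v) \<notin> connection G (A - {e})"
proof
  assume "(u, v) \<in> connection G (A - {e})"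
  then obtain vs es where p: "vs \<noteq> []" "hd vs = u" "last vs = v" "distinct vs"
    "length vs = Suc (length es)" "set es \<subseteq> A - {e}"
    "\<And>k. k < length es \<Longrightarrow> ends G (es ! k) = {vs ! k, vs ! Suc k}"
    by (rule connection_simple_path) blast
  \<comment> \<open>Distinct vertices make the consecutive pairs distinct as sets, and hence the
    edges.\<close>
  have "distinct es"
    unfolding distinct_conv_nth
  proof (intro allI impI)
    fix k l assume kl: "k < length es" "l < length es" "k \<noteq> l"
    have "{vs ! k, vs ! Suc k} \<noteq> {vs ! l, vs ! Suc l}"
      using kl p(4,5) by (simp add: doubleton_eq_iff nth_eq_iff_index_eq)
    then show "es ! k \<noteq> es ! l" using p(7) kl by metis
  qed
  moreover have "vs ! 0 = u" "vs ! length es = v"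
    using p by (simp_all add: hd_conv_nth last_conv_nth)
  ultimately have "is_cycle G vs (es @ [e])"
    using p assms(4) by (auto simp: is_cycle_def nth_append less_Suc_eq mod_Suc insert_commute)
  moreover have "set (es @ [e]) \<subseteq> A" using p assms(3) by auto
  ultimately show False using assms(1) unfolding acyclic_edges_def by blast
qed

end

text \<open>A new cycle must pass through \<open>e\<close>; the rest of it would connect the ends of
  \<open>e\<close> inside \<open>A\<close>.\<close>

lemma acyclic_edges_insert:
  assumes "acyclic_edges G A" "ends G e = {u, v}" "(u, v) \<notin> connection G A"
  shows "acyclic_edges G (insert e A)"
  unfolding acyclic_edges_def
proof clarify
  fix vs es assume c: "is_cycle G vs es" and sub: "set es \<subseteq> insert e A"
  define n where "n = length es"
  have d: "distinct es" and n: "n > 0"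
    and ends: "\<And>k. k < n \<Longrightarrow> ends G (es ! k) = {vs ! k, vs ! (Suc k mod n)}"
    using c by (auto simp: is_cycle_def n_def)
  have "e \<in> set es"
    using assms(1) c sub unfolding acyclic_edges_def by blast
  then obtain k where k: "k < n" "es ! k = e" by (auto simp: in_set_conv_nth n_def)
  \<comment> \<open>Walk around the cycle starting just behind \<open>e\<close>, which stands at
    position \<open>k\<close>. In at most \<open>n - 1\<close> steps \<open>e\<close> is not met
    again, and exactly \<open>n - 1\<close> steps reach the other end of \<open>e\<close>.\<close>
  have "m < n \<Longrightarrow> (vs ! (Suc k mod n), vs ! (Suc (k + m) mod n)) \<in> connection G A" for m
  proof (induction m)
    case (Suc m)
    define l where "l = Suc (k + m) mod n"
    have l: "l < n" using n by (simp add: l_def)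
    have "l \<noteq> k"
    proof
      assume "l = k"
      then have "(k + Suc m) mod n = (k + 0) mod n" using k by (simp add: l_def)
      then have "Suc m mod n = 0"
        by (metis add_diff_cancel_left mod_0 mod_eq_dvd_iff_nat dvd_imp_mod_0 diff_zero le_add1 add_0_right le0)
      then show False using Suc.prems by simp
    qed
    then have "es ! l \<noteq> e" using d k l by (metis n_def nth_eq_iff_index_eq)
    then have "es ! l \<in> A" using sub l nth_mem[of l es] unfolding n_def by blast
    then have "(vs ! l, vs ! (Suc l mod n)) \<in> connection G A"
      using ends[OF l] by (rule connection_edge)
    moreover have "Suc l mod n = Suc (k + Suc m) mod n"
      by (simp add: l_def mod_Suc_eq)
    ultimately show ?case
      using Suc connection_trans by (fastforce simp: l_def)
  qed simp
  from this[of "n - 1"] have "(vs ! (Suc k mod n), vs ! k) \<in> connection G A"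
    using n k by simp
  moreover have "{u, v} = {vs ! k, vs ! (Suc k mod n)}"
    using ends[OF k(1)] k assms(2) by simp
  ultimately show False
    using assms(3) by (auto simp: doubleton_eq_iff connection_commute)
qed

section \<open>Choices of roots\<close>

text \<open>The weight of a rooted forest ignores its roots, so sums over rooted forests become sums
  over edge sets, weighted by the number of root choices.\<close>

lemma sum_fst_Sigma:
  assumes "finite S" "\<And>A. A \<in> S \<Longrightarrow> finite (T A)"
  shows "(\<Sum>F\<in>Sigma S T. f (fst F)) = (\<Sum>A\<in>S. f A * real (card (T A)))"
proof -
  have "(\<Sum>A\<in>S. \<Sum>R\<in>T A. f A) = (\<Sum>(A, R)\<in>Sigma S T. f A)"
    using assms by (intro sum.Sigma) auto
  then show ?thesis by (simp add: case_prod_unfold mult.commute)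
qed

text \<open>Components are represented by their vertices, so that no quotient set has to be
  handled.\<close>

definition root_sets :: "('v, 'e) multigraph \<Rightarrow> 'e set \<Rightarrow> 'v set set" where
  "root_sets G A = {R. \<forall>x. \<exists>!r. (x, r) \<in> connection G A \<and> r \<in> R}"

lemma spanning_rooted_forests_eq:
  "spanning_rooted_forests G = (SIGMA A:{A. A \<subseteq> edges G \<and> acyclic_edges G A}. root_sets G A)"
  by (auto simp: spanning_rooted_forests_def root_sets_def graph_components_def quotient_def)

lemma root_sets_unique:
  "R \<in> root_sets G A \<Longrightarrow> x \<in> R \<Longrightarrow> y \<in> R \<Longrightarrow> (x, y) \<in> connection G A \<Longrightarrow> x = y"
  by (auto simp: root_sets_def) (metis connection_refl)

lemma root_sets_exists:
  assumes "R \<in> root_sets G A" obtains r where "r \<in> R" "(x, r) \<in> connection G A"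
  using assms by (auto simp: root_sets_def) blast

lemma root_setsI:
  assumes "\<And>x. \<exists>r\<in>R. (x, r) \<in> connection G A"
    and "\<And>x y. x \<in> R \<Longrightarrow> y \<in> R \<Longrightarrow> (x, y) \<in> connection G A \<Longrightarrow> x = y"
  shows "R \<in> root_sets G A"
  unfolding root_sets_def
proof (intro CollectI allI ex_ex1I)
  show "\<exists>r. (x, r) \<in> connection G A \<and> r \<in> R" for x
    using assms(1)[of x] by blast
  show "r = s" if "(x, r) \<in> connection G A \<and> r \<in> R" "(x, s) \<in> connection G A \<and> s \<in> R" for x r s
    using that assms(2)[of r s] connection_trans[of r x G A s] connection_commute[of r x G A] by blast
qed

lemma move_root:
  assumes "R \<in> root_sets G A" "i \<in> R" "(i, j) \<in> connection G A"
  shows "insert j (R - {i}) \<in> root_sets G A"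
proof (rule root_setsI)
  fix x
  obtain r where r: "r \<in> R" "(x, r) \<in> connection G A" using root_sets_exists[OF assms(1)] .
  show "\<exists>r\<in>insert j (R - {i}). (x, r) \<in> connection G A"
    using r assms connection_trans[of _ _ G A] by (cases "r = i") auto
next
  fix x y assume "x \<in> insert j (R - {i})" "y \<in> insert j (R - {i})" "(x, y) \<in> connection G A"
  then show "x = y"
    using assms root_sets_unique[OF assms(1)]
    by (metis Diff_iff connection_commute connection_trans insert_iff)
qed

definition rooted_at :: "('v, 'e) multigraph \<Rightarrow> 'e set \<Rightarrow> 'v \<Rightarrow> 'v set set" where
  "rooted_at G A i = {R \<in> root_sets G A. i \<in> R}"

text \<open>Moving the root from \<open>i\<close> to \<open>j\<close> within their tree is a
  bijection, undone by moving it back.\<close>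

lemma card_rooted_at_connected:
  assumes "(i, j) \<in> connection G A"
  shows "card (rooted_at G A i) = card (rooted_at G A j)"
proof (rule bij_betw_same_card)
  have *: "insert i (insert j (R - {i}) - {j}) = R" if "R \<in> rooted_at G A i" "(i, j) \<in> connection G A"
    for i j :: 'a and R
    using that root_sets_unique[of R G A i j] by (auto simp: rooted_at_def)
  have **: "(\<lambda>R. insert j (R - {i})) ` rooted_at G A i \<subseteq> rooted_at G A j"
    if "(i, j) \<in> connection G A" for i j
    using that move_root[of _ G A i j] by (auto simp: rooted_at_def)
  have "(j, i) \<in> connection G A" using assms by (simp only: connection_commute)
  then show "bij_betw (\<lambda>R. insert j (R - {i})) (rooted_at G A i) (rooted_at G A j)"
    using assms
    by (intro bij_betw_byWitness[where f' = "\<lambda>R. insert i (R - {j})"] ballI ** *) assumption+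
qed

text \<open>The root sets fall into classes by the root of the tree of \<open>i\<close>, and all
  these classes have the same size.\<close>

lemma card_root_sets:
  fixes G :: "('v::finite, 'e) multigraph"
  shows "card (root_sets G A) = card (rooted_at G A i) * card {r. (i, r) \<in> connection G A}"
proof -
  have "root_sets G A = (\<Union>r\<in>{r. (i, r) \<in> connection G A}. rooted_at G A r)"
    by (auto simp: rooted_at_def elim: root_sets_exists)
  moreover have "card \<dots> = (\<Sum>r\<in>{r. (i, r) \<in> connection G A}. card (rooted_at G A r))"
  proof (intro card_UN_disjoint ballI impI)
    fix r s assume "r \<in> {r. (i, r) \<in> connection G A}" "s \<in> {r. (i, r) \<in> connection G A}" "r \<noteq> s"
    then have "(r, s) \<in> connection G A"
      using connection_trans[of _ _ G A] connection_commute[of _ _ G A] by blast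
    then show "rooted_at G A r \<inter> rooted_at G A s = {}"
      using root_sets_unique[of _ G A r s] \<open>r \<noteq> s\<close> by (auto simp: rooted_at_def)
  qed auto
  moreover have "\<dots> = (\<Sum>r\<in>{r. (i, r) \<in> connection G A}. card (rooted_at G A i))"
    by (intro sum.cong card_rooted_at_connected[symmetric]) auto
  ultimately show ?thesis by simp
qed

text \<open>
  Deleting an edge of the tree of \<open>i\<close> splits off a second tree, whose root can be chosen freely.
\<close>

lemma card_rooted_at_insert:
  fixes G :: "('v::finite, 'e) multigraph"
  assumes e: "ends G e = {u, v}" and sep: "(u, v) \<notin> connection G A"
    and i: "(i, u) \<in> connection G A"
  shows "card (rooted_at G A i) =
    card (rooted_at G (insert e A) i) *
    card {r. (i, r) \<in> connection G (insert e A) \<and> (i, r) \<notin> connection G A}"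
proof -
  let ?B = "insert e A"
  let ?D = "{r. (i, r) \<in> connection G ?B \<and> (i, r) \<notin> connection G A}"
  let ?N = "\<lambda>r. {R \<in> root_sets G A. i \<in> R \<and> r \<in> R}"
  note tr = connection_trans[of _ _ G A] and sy = connection_commute[of _ _ G A]
  \<comment> \<open>As \<open>u\<close> is connected to \<open>i\<close> in \<open>A\<close>, the
    vertex \<open>i\<close> can stand for \<open>u\<close>; it follows that \<open>?D\<close> is the
    tree of \<open>v\<close> in \<open>A\<close>.\<close>
  have B: "(x, y) \<in> connection G ?B \<longleftrightarrow> (x, y) \<in> connection G A \<or>
    (x, i) \<in> connection G A \<and> (v, y) \<in> connection G A \<or>
    (x, v) \<in> connection G A \<and> (i, y) \<in> connection G A" for x y
    unfolding connection_insert[OF e] using i tr sy by blast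
  have iv: "(i, v) \<notin> connection G A" using sep i tr sy by blast
  have D: "r \<in> ?D \<longleftrightarrow> (v, r) \<in> connection G A" for r
    using B[of i r] iv connection_refl[of i G A] tr sy by blast
  \<comment> \<open>For a fixed root \<open>r\<close> of the tree split off, dropping
    \<open>r\<close> is a bijection with inverse \<open>insert r\<close>.\<close>
  have "card (?N r) = card (rooted_at G ?B i)" if r: "r \<in> ?D" for r
  proof (rule bij_betw_same_card)
    have vr: "(v, r) \<in> connection G A" using r D by blast
    have 1: "R - {r} \<in> rooted_at G ?B i" if R: "R \<in> root_sets G A" "i \<in> R" "r \<in> R" for R
    proof -
      have "R - {r} \<in> root_sets G ?B"
      proof (rule root_setsI)
        fix x
        obtain s where s: "s \<in> R" "(x, s) \<in> connection G A" using root_sets_exists[OF R(1)] .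
        show "\<exists>s\<in>R - {r}. (x, s) \<in> connection G ?B"
        proof (cases "s = r")
          case True
          then have "(x, i) \<in> connection G ?B" using s vr B tr sy by (metis connection_refl)
          then show ?thesis using R r by auto
        next
          case False
          then show ?thesis using s B by blast
        qed
      next
        fix x y assume xy: "x \<in> R - {r}" "y \<in> R - {r}" "(x, y) \<in> connection G ?B"
        have "(v, z) \<notin> connection G A" if "z \<in> R - {r}" for z
          using root_sets_unique[OF R(1), of z r] that R vr tr sy by blast
        then have "(x, y) \<in> connection G A" using xy B sy by blast
        then show "x = y" using root_sets_unique[OF R(1)] xy by blast
      qed
      then show ?thesis using R r by (auto simp: rooted_at_def)
    qed
    have 2: "insert r R \<in> ?N r \<and> r \<notin> R" if R: "R \<in> rooted_at G ?B i" for R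
    proof -
      have R': "R \<in> root_sets G ?B" "i \<in> R" using R by (auto simp: rooted_at_def)
      \<comment> \<open>In \<open>?B\<close> the tree of \<open>v\<close> is merged into that of
        \<open>i\<close>, whose only root is \<open>i\<close>.\<close>
      have no: "(v, z) \<notin> connection G A" if "z \<in> R" for z
        using root_sets_unique[OF R'(1), of i z] that R' B iv sy by (metis connection_refl)
      have "insert r R \<in> root_sets G A"
      proof (rule root_setsI)
        fix x
        obtain s where s: "s \<in> R" "(x, s) \<in> connection G ?B" using root_sets_exists[OF R'(1)] .
        then show "\<exists>s\<in>insert r R. (x, s) \<in> connection G A"
          using B no R' vr tr by blast
      next
        fix x y assume "x \<in> insert r R" "y \<in> insert r R" "(x, y) \<in> connection G A"
        then show "x = y"
          using root_sets_unique[OF R'(1), of x y] no vr B tr sy by blast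
      qed
      then show ?thesis using R' no vr by auto
    qed
    show "bij_betw (\<lambda>R. R - {r}) (?N r) (rooted_at G ?B i)"
      using 1 2 by (intro bij_betw_byWitness[where f' = "insert r"]) auto
  qed
  moreover have "rooted_at G A i = (\<Union>r\<in>?D. ?N r)"
    unfolding rooted_at_def using D by (auto elim: root_sets_exists)
  moreover have "card (\<Union>r\<in>?D. ?N r) = (\<Sum>r\<in>?D. card (?N r))"
  proof (intro card_UN_disjoint ballI impI)
    fix r s assume "r \<in> ?D" "s \<in> ?D" "r \<noteq> s"
    then have "(r, s) \<in> connection G A" using D tr sy by blast
    then show "?N r \<inter> ?N s = {}" using root_sets_unique[of _ G A r s] \<open>r \<noteq> s\<close> by blast
  qed auto
  ultimately show ?thesis by simp
qed

section \<open>The flow of a path in a forest\<close>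

text \<open>For an edge \<open>e\<close>, this is entry \<open>j\<close> of the Laplacian of
  \<open>e\<close> alone, with unit weight, applied to the potential \<open>f\<close>. The sum has
  at most one term.\<close>

definition edge_flow :: "('v::finite, 'e) multigraph \<Rightarrow> 'e \<Rightarrow> ('v \<Rightarrow> real) \<Rightarrow> 'v \<Rightarrow> real" where
  "edge_flow G e f j = (\<Sum>k | ends G e = {j, k}. f j - f k)"

lemma edge_flow_eq:
  assumes "ends G e = {u, v}" "u \<noteq> v"
  shows "edge_flow G e f j = (of_bool (u = j) - of_bool (v = j)) * (f u - f v)"
proof -
  have "{k. ends G e = {j, k}} = (if u = j then {v} else if v = j then {u} else {})"
    using assms by (auto simp: doubleton_eq_iff)
  then show ?thesis using assms by (simp add: edge_flow_def)
qed

lemma edge_flow_sum: "edge_flow G e (\<lambda>x. \<Sum>a\<in>S. c a * f a x) j = (\<Sum>a\<in>S. c a * edge_flow G e (f a) j)"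
  unfolding edge_flow_def
  by (simp add: sum_subtractf[symmetric] right_diff_distrib[symmetric] sum_distrib_left sum.swap[of _ S])

context weighted_multigraph
begin

text \<open>
  The edges of a forest that separate \<open>i\<close> from \<open>r\<close> form the path from \<open>i\<close> to \<open>r\<close>, which carries a
  unit flow with source \<open>i\<close> and sink \<open>r\<close>.
\<close>

lemma path_flow:
  assumes B: "acyclic_edges G B" "B \<subseteq> edges G" and "(i, r) \<in> connection G B"
  shows "(\<Sum>e\<in>B. of_bool ((i, r) \<notin> connection G (B - {e})) *
      edge_flow G e (\<lambda>x. of_bool ((i, x) \<in> connection G (B - {e}))) j)
    = of_bool (i = j) - of_bool (r = j)"
  using assms(3) unfolding connection_def[of G B]
proof (induction rule: rtrancl_induct)
  case base
  then show ?case by simp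
next
  case (step y z)
  let ?C = "\<lambda>e. connection G (B - {e})"
  let ?t = "\<lambda>r e. of_bool ((i, r) \<notin> ?C e) * edge_flow G e (\<lambda>x. of_bool ((i, x) \<in> ?C e)) j"
  obtain e where e: "e \<in> B" "ends G e = {y, z}" using step by blast
  have yz: "y \<noteq> z" using no_loops[of e] e B(2) by auto
  have fin: "finite B" using B(2) finite_edges by (rule finite_subset)
  \<comment> \<open>An edge \<open>a\<close> other than \<open>e\<close> does not separate
    \<open>y\<close> from \<open>z\<close>, as \<open>e\<close> still joins them; only the term of
    \<open>e\<close> can change.\<close>
  have "?t y a = ?t z a" if "a \<in> B - {e}" for a
  proof -
    have "(y, z) \<in> ?C a" using that e by (intro connection_edge[of e]) auto
    then have "(i, y) \<in> ?C a \<longleftrightarrow> (i, z) \<in> ?C a"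
      using connection_trans connection_commute by metis
    then show ?thesis by simp
  qed
  then have "(\<Sum>a\<in>B - {e}. ?t z a) = (\<Sum>a\<in>B - {e}. ?t y a)" by (intro sum.cong) (simp_all only:)
  then have diff: "(\<Sum>a\<in>B. ?t z a) - (\<Sum>a\<in>B. ?t y a) = ?t z e - ?t y e"
    using sum.remove[OF fin e(1), of "?t z"] sum.remove[OF fin e(1), of "?t y"] by linarith
  have "(y, z) \<notin> ?C e" using acyclic_edge_bridge[OF B e] .
  moreover have "(i, y) \<in> connection G B" using step(1) by (simp add: connection_def)
  then have "(i, y) \<in> ?C e \<or> (i, z) \<in> ?C e"
    using connection_insert[OF e(2), of i y "B - {e}"] e(1) by (auto simp: insert_absorb)
  \<comment> \<open>Exactly one end of the bridge \<open>e\<close> stays on the side of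
    \<open>i\<close>. If it is \<open>y\<close>, the path gains \<open>e\<close>, otherwise it loses
    \<open>e\<close>; the flow changes by the same amount in both cases.\<close>
  ultimately have "(i, y) \<in> ?C e \<longleftrightarrow> (i, z) \<notin> ?C e"
    using connection_trans connection_commute by metis
  then have "?t z e - ?t y e = of_bool (y = j) - of_bool (z = j)"
    by (auto simp: edge_flow_eq[OF e(2) yz])
  then show ?case using diff step.IH by linarith
qed

section \<open>The matrix forest theorem\<close>

definition forests :: "'e set set" where
  "forests = {A. A \<subseteq> edges G \<and> acyclic_edges G A}"

text \<open>The weight \<open>f(i, j)\<close> of the rooted forests whose tree with root
  \<open>i\<close> contains \<open>j\<close>; root sets are counted, not enumerated.\<close>

definition tree_weight :: "'v \<Rightarrow> 'v \<Rightarrow> real" where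
  "tree_weight i j = (\<Sum>A\<in>forests. prod (weight G) A * real (card (rooted_at G A i)) *
     of_bool ((i, j) \<in> connection G A))"

definition total_weight :: real where
  "total_weight = (\<Sum>A\<in>forests. prod (weight G) A * real (card (root_sets G A)))"

lemma finite_forests_edges: "finite forests"
  unfolding forests_def using finite_edges by simp

lemma finite_forest: "A \<in> forests \<Longrightarrow> finite A"
  unfolding forests_def using finite_edges finite_subset by blast

text \<open>Entry \<open>(i, j)\<close> of \<open>f (I + L) = \<sigma> I\<close>, with row
  \<open>i\<close> of \<open>f\<close> as the potential and \<open>f L\<close> written as a sum over
  edges.\<close>

lemma tree_weight_balance:
  "tree_weight i j + (\<Sum>e\<in>edges G. weight G e * edge_flow G e (tree_weight i) j) =
    total_weight * of_bool (i = j)"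
proof -
  let ?c = "\<lambda>A x. of_bool ((i, x) \<in> connection G A) :: real"
  let ?N = "\<lambda>A. real (card (rooted_at G A i))"
  let ?w = "prod (weight G)"
  define t where "t A e = weight G e * (?w A * ?N A * edge_flow G e (?c A) j)" for A e
  \<comment> \<open>If \<open>e\<close> lies in \<open>A\<close> or closes a cycle, its ends belong
    to one tree of \<open>A\<close>, on which the indicator of the tree of \<open>i\<close> is
    constant.\<close>
  have flow0: "t A e = 0" if A: "A \<in> forests" and e: "e \<in> edges G"
    and "\<not> (e \<notin> A \<and> insert e A \<in> forests)" for A e
  proof -
    obtain u v where uv: "ends G e = {u, v}" "u \<noteq> v" using e by (rule edge_ends)
    have "(u, v) \<in> connection G A"
      using that acyclic_edges_insert[OF _ uv(1), of A] connection_edge[of e A G u v] uv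
      by (auto simp: forests_def)
    then have "(i, u) \<in> connection G A \<longleftrightarrow> (i, v) \<in> connection G A"
      using connection_trans connection_commute by metis
    then show ?thesis by (simp add: t_def edge_flow_eq[OF uv])
  qed
  have "(\<Sum>e\<in>edges G. weight G e * edge_flow G e (tree_weight i) j)
      = (\<Sum>e\<in>edges G. \<Sum>A\<in>forests. t A e)"
    unfolding tree_weight_def[abs_def] edge_flow_sum t_def by (simp add: sum_distrib_left)
  also have "\<dots> = (\<Sum>(A, e)\<in>forests \<times> edges G. t A e)"
    by (subst sum.swap) (simp add: sum.cartesian_product)
  also have "\<dots> = (\<Sum>(A, e)\<in>{(A, e). A \<in> forests \<and> e \<in> edges G \<and> e \<notin> A \<and> insert e A \<in> forests}. t A e)"
    by (rule sum.mono_neutral_right) (use flow0 in \<open>auto simp: finite_forests_edges finite_edges\<close>)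
  \<comment> \<open>Reindexing by the larger forest \<open>B = insert e A\<close>, from which
    \<open>A\<close> is recovered as \<open>B - {e}\<close>.\<close>
  also have "\<dots> = (\<Sum>(B, e)\<in>(SIGMA B:forests. B). t (B - {e}) e)"
    by (rule sum.reindex_bij_witness[where i = "\<lambda>(B, e). (B - {e}, e)" and j = "\<lambda>(A, e). (insert e A, e)"])
      (auto simp: insert_absorb forests_def intro: acyclic_edges_subset)
  also have "\<dots> = (\<Sum>B\<in>forests. \<Sum>e\<in>B. t (B - {e}) e)"
    by (rule sum.Sigma[symmetric]) (auto simp: finite_forests_edges finite_forest)
  also have "\<dots> = (\<Sum>B\<in>forests. ?w B * ?N B *
      (real (card {r. (i, r) \<in> connection G B}) * of_bool (i = j) - ?c B j))"
  proof (rule sum.cong[OF refl])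
    fix B assume B: "B \<in> forests"
    then have B': "acyclic_edges G B" "B \<subseteq> edges G" by (auto simp: forests_def)
    let ?T = "{r. (i, r) \<in> connection G B}"
    have "t (B - {e}) e = ?w B * ?N B *
        (\<Sum>r\<in>?T. of_bool ((i, r) \<notin> connection G (B - {e})) * edge_flow G e (?c (B - {e})) j)"
      if e: "e \<in> B" for e
    proof -
      let ?A = "B - {e}"
      have ins: "insert e ?A = B" using e by auto
      obtain u v where uv: "ends G e = {u, v}" "u \<noteq> v" using e B' edge_ends by blast
      have w: "weight G e * ?w ?A = ?w B"
        using prod.remove[OF finite_forest[OF B] e, of "weight G"] by simp
      have sep: "(u, v) \<notin> connection G ?A" by (rule acyclic_edge_bridge[OF B' e uv(1)])
      have "?N ?A * edge_flow G e (?c ?A) j =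
        ?N B * real (card {r \<in> ?T. (i, r) \<notin> connection G ?A}) * edge_flow G e (?c ?A) j"
      \<comment> \<open>Whichever end is connected to \<open>i\<close> serves as the vertex
        \<open>u\<close> of \<open>card_rooted_at_insert\<close>. If neither is, the indicator is 0
        at both ends and both sides vanish.\<close>
      proof (cases "(i, u) \<in> connection G ?A \<or> (i, v) \<in> connection G ?A")
        case True
        then have "card (rooted_at G ?A i) =
          card (rooted_at G B i) * card {r \<in> ?T. (i, r) \<notin> connection G ?A}"
          using card_rooted_at_insert[of G e u v ?A i] card_rooted_at_insert[of G e v u ?A i]
            uv sep ins connection_commute[of u v G ?A] by (auto simp: insert_commute)
        then show ?thesis by simp
      qed (simp add: edge_flow_eq[OF uv])
      moreover have "real (card {r \<in> ?T. (i, r) \<notin> connection G ?A}) =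
          (\<Sum>r\<in>?T. of_bool ((i, r) \<notin> connection G ?A))"
        by (simp add: of_bool_def sum.If_cases Int_def)
      ultimately show ?thesis
        unfolding t_def w[symmetric] by (simp add: sum_distrib_right[symmetric] mult_ac)
    qed
    then have "(\<Sum>e\<in>B. t (B - {e}) e) = ?w B * ?N B * (\<Sum>e\<in>B. \<Sum>r\<in>?T.
        of_bool ((i, r) \<notin> connection G (B - {e})) * edge_flow G e (?c (B - {e})) j)"
      by (simp add: sum_distrib_left)
    also have "\<dots> = ?w B * ?N B * (\<Sum>r\<in>?T. of_bool (i = j) - of_bool (r = j))"
      by (subst sum.swap) (simp add: path_flow[OF B'])
    also have "(\<Sum>r\<in>?T. of_bool (i = j) - of_bool (r = j)) = real (card ?T) * of_bool (i = j) - ?c B j"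
      by (simp add: sum_subtractf)
    finally show "(\<Sum>e\<in>B. t (B - {e}) e) =
      ?w B * ?N B * (real (card ?T) * of_bool (i = j) - ?c B j)" .
  qed
  \<comment> \<open>The terms with \<open>- ?c B j\<close> cancel \<open>tree_weight i j\<close>,
    and \<open>card_root_sets\<close> turns the remaining ones into
    \<open>total_weight\<close>.\<close>
  finally show ?thesis
    unfolding tree_weight_def total_weight_def card_root_sets[of G _ i]
    by (simp add: sum.distrib[symmetric] sum_distrib_right algebra_simps)
qed

section \<open>From sums over edges to the inverse matrix\<close>

lemma total_weight_eq:
  "(\<Sum>F\<in>spanning_rooted_forests G. forest_weight G F) = total_weight"
  unfolding spanning_rooted_forests_eq total_weight_def forest_weight_def forests_def
  by (rule sum_fst_Sigma) (simp_all add: finite_edges)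

text \<open>Symmetry turns column \<open>j\<close> into a row, the vanishing row sum produces the
  differences \<open>f j - f k\<close>, and each entry is then split into its edges.\<close>

lemma laplacian_sum:
  "(\<Sum>k\<in>UNIV. f k * laplacian G $ k $ j) = (\<Sum>e\<in>edges G. weight G e * edge_flow G e f j)"
proof -
  have sym: "lap_off G k j = lap_off G j k" for k by (simp add: lap_off_def insert_commute)
  have "(\<Sum>k\<in>UNIV. f k * laplacian G $ k $ j) =
      f j * laplacian G $ j $ j + (\<Sum>k\<in>UNIV - {j}. f k * laplacian G $ k $ j)"
    by (rule sum.remove) auto
  also have "(\<Sum>k\<in>UNIV - {j}. f k * laplacian G $ k $ j) = (\<Sum>k\<in>UNIV - {j}. f k * lap_off G j k)"
    by (rule sum.cong) (auto simp: laplacian_def sym)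
  also have "f j * laplacian G $ j $ j + \<dots> = (\<Sum>k\<in>UNIV - {j}. - lap_off G j k * (f j - f k))"
    by (simp add: laplacian_def sum_distrib_left sum_subtractf right_diff_distrib sum_negf mult.commute)
  also have "\<dots> = (\<Sum>k\<in>UNIV. - lap_off G j k * (f j - f k))"
    by (rule sum.mono_neutral_left) auto
  also have "\<dots> = (\<Sum>k\<in>UNIV. \<Sum>e\<in>edges G. if ends G e = {j, k} then weight G e * (f j - f k) else 0)"
    by (simp add: lap_off_def sum_distrib_right sum.inter_filter[OF finite_edges, symmetric])
  also have "\<dots> = (\<Sum>e\<in>edges G. weight G e * edge_flow G e f j)"
    by (subst sum.swap) (simp add: edge_flow_def sum_distrib_left sum.inter_filter[OF finite, symmetric] flip: sum.inter_filter)
  finally show ?thesis .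
qed

text \<open>The equation \<open>F (I + L) = \<sigma> I\<close> and invertibility determine the
  inverse. The parameter is 1 here because \<alpha> is absorbed into the weights.\<close>

theorem matrix_forest:
  "matrix_inv (mat 1 + laplacian G) $ i $ j = tree_weight i j / total_weight"
proof -
  let ?M = "mat 1 + laplacian G"
  define F where "F = ((\<chi> i j. tree_weight i j) :: real ^ 'v ^ 'v)"
  have inv: "?M ** matrix_inv ?M = mat 1"
    using invertible_id_plus_laplacian[of 1] unfolding invertible_def matrix_inv_def
    by (simp only: scaleR_one zero_less_one) (rule someI_ex[THEN conjunct1], simp)
  have "(F ** ?M) $ i $ j = (total_weight *\<^sub>R mat 1 :: real ^ 'v ^ 'v) $ i $ j" for i j
  proof -
    have "(F ** ?M) $ i $ j =
        (\<Sum>k\<in>UNIV. tree_weight i k * of_bool (k = j)) + (\<Sum>k\<in>UNIV. tree_weight i k * laplacian G $ k $ j)"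
      by (simp add: matrix_matrix_mult_def F_def mat_def of_bool_def distrib_left sum.distrib)
    also have "\<dots> = total_weight * of_bool (i = j)"
      unfolding laplacian_sum tree_weight_balance[symmetric]
      by (simp add: of_bool_def if_distrib[of "(*) _"] cong: if_cong)
    finally show ?thesis by (simp add: mat_def)
  qed
  then have "F ** ?M = total_weight *\<^sub>R mat 1" by (simp add: vec_eq_iff)
  then have "F ** (?M ** matrix_inv ?M) = total_weight *\<^sub>R matrix_inv ?M"
    by (simp add: matrix_mul_assoc flip: scalar_matrix_assoc)
  then have "F = total_weight *\<^sub>R matrix_inv ?M" by (simp add: inv)
  then have "tree_weight i j = total_weight * matrix_inv ?M $ i $ j"
    by (simp add: F_def vec_eq_iff)
  then show ?thesis using total_forest_weight_pos total_weight_eq by simp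
qed

section \<open>Probability of an unsuccessful connection\<close>

lemma unsuccessful_connection_iff:
  "unsuccessful_connection G i j (A, R) \<longleftrightarrow>
    A \<in> forests \<and> R \<in> rooted_at G A i \<and> (i, j) \<notin> connection G A"
proof -
  have "(\<exists>C\<in>graph_components G A. i \<in> C \<and> j \<notin> C) \<longleftrightarrow> (i, j) \<notin> connection G A"
  proof
    assume "\<exists>C\<in>graph_components G A. i \<in> C \<and> j \<notin> C"
    then obtain x where "(x, i) \<in> connection G A" "(x, j) \<notin> connection G A"
      by (auto simp: graph_components_def quotient_def)
    then show "(i, j) \<notin> connection G A" by (metis connection_trans)
  next
    assume "(i, j) \<notin> connection G A"
    then show "\<exists>C\<in>graph_components G A. i \<in> C \<and> j \<notin> C"
      by (intro bexI[of _ "connection G A `` {i}"]) (auto simp: graph_components_def quotient_def)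
  qed
  then show ?thesis
    unfolding unsuccessful_connection_def
    by (auto simp: spanning_rooted_forests_eq forests_def rooted_at_def)
qed

text \<open>\<open>tree_weight i i\<close> covers all forests with \<open>i\<close> as a root;
  removing those whose tree of \<open>i\<close> contains \<open>j\<close> leaves the unsuccessful
  ones.\<close>

lemma prob_unsuccessful_connection:
  "measure_pmf.prob (random_forest G) {F. unsuccessful_connection G i j F} =
    (tree_weight i i - tree_weight i j) / total_weight"
proof -
  let ?U = "{F. unsuccessful_connection G i j F}"
  have sub: "?U \<subseteq> spanning_rooted_forests G" by (auto simp: unsuccessful_connection_def)
  have U: "?U = (SIGMA A:{A \<in> forests. (i, j) \<notin> connection G A}. rooted_at G A i)"
    by (auto simp: unsuccessful_connection_iff)
  have "measure_pmf.prob (random_forest G) ?U = (\<Sum>F\<in>?U. forest_weight G F / total_weight)"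
    using sub finite_subset[OF sub finite_forests]
    by (subst measure_measure_pmf_finite)
      (auto simp: pmf_random_forest forest_prob_def total_weight_eq intro!: sum.cong)
  also have "\<dots> = (\<Sum>F\<in>?U. forest_weight G F) / total_weight"
    by (simp add: sum_divide_distrib)
  also have "(\<Sum>F\<in>?U. forest_weight G F) =
      (\<Sum>A | A \<in> forests \<and> (i, j) \<notin> connection G A. prod (weight G) A * real (card (rooted_at G A i)))"
    unfolding U forest_weight_def
    by (rule sum_fst_Sigma) (simp_all add: finite_forests_edges)
  also have "\<dots> = tree_weight i i - tree_weight i j"
    unfolding tree_weight_def sum_subtractf[symmetric] sum.inter_filter[OF finite_forests_edges]
    by (rule sum.cong) auto
  finally show ?thesis .
qed

end

section \<open>Scaling, the coin toss and the conclusion\<close>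

lemma laplacian_scale_weights: "laplacian (scale_weights \<alpha> G) = \<alpha> *\<^sub>R laplacian G"
proof -
  have "lap_off (scale_weights \<alpha> G) i j = \<alpha> * lap_off G i j" for i j
    by (simp add: lap_off_def scale_weights_def sum_distrib_left)
  then show ?thesis by (simp add: laplacian_def vec_eq_iff sum_distrib_left)
qed

lemma prob_pair_bernoulli_half:
  "measure_pmf.prob (pair_pmf (bernoulli_pmf (1/2)) p) {(c, x). if c then P x else Q x} =
    1/2 * (measure_pmf.prob p {x. P x} + measure_pmf.prob p {x. Q x})"
proof -
  let ?M = "pair_pmf (bernoulli_pmf (1/2)) p"
  have half: "measure_pmf.prob ?M ({c} \<times> A) = 1/2 * measure_pmf.prob p A" for c A
  proof -
    \<comment> \<open>The product rule asks for countable sets, hence the restriction to the support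
      of \<open>p\<close>.\<close>
    have "measure_pmf.prob ?M ({c} \<times> A) = measure_pmf.prob ?M ({c} \<times> (A \<inter> set_pmf p))"
      by (rule measure_prob_cong_0) (auto simp: pmf_pair set_pmf_iff)
    also have "\<dots> = measure_pmf.prob (bernoulli_pmf (1/2)) {c} * measure_pmf.prob p (A \<inter> set_pmf p)"
      by (rule measure_pmf_prob_product) auto
    finally show ?thesis by (cases c) (simp_all add: measure_pmf_single measure_Int_set_pmf)
  qed
  have "{(c, x). if c then P x else Q x} = {True} \<times> {x. P x} \<union> {False} \<times> {x. Q x}"
    by (auto split: if_splits)
  also have "measure_pmf.prob ?M \<dots> =
    measure_pmf.prob ?M ({True} \<times> {x. P x}) + measure_pmf.prob ?M ({False} \<times> {x. Q x})"
    by (rule measure_pmf.finite_measure_Union) auto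
  finally show ?thesis by (simp only: half distrib_left)
qed

theorem proposition10:
  fixes G :: "('v::finite, 'e) multigraph" and \<alpha> :: real and i j :: 'v
  assumes "\<alpha> > 0" and "weighted_multigraph G"
  shows "forest_dist \<alpha> G i j =
    measure_pmf.prob (connection_model \<alpha> G) (unsuccessful_event \<alpha> G i j)"
proof -
  interpret H: weighted_multigraph "scale_weights \<alpha> G"
    using assms by (intro weighted_multigraph_scale)
  have "forest_accessibility \<alpha> G $ x $ y = H.tree_weight x y / H.total_weight" for x y
    using H.matrix_forest by (simp add: forest_accessibility_def laplacian_scale_weights)
  \<comment> \<open>The distance is the mean of \<open>q(i, i) - q(i, j)\<close> and
    \<open>q(j, j) - q(j, i)\<close>, the probabilities of failure given each outcome of the
    coin.\<close>
  then show ?thesis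
    by (simp add: forest_dist_def connection_model_def unsuccessful_event_def Let_def
        prob_pair_bernoulli_half H.prob_unsuccessful_connection diff_divide_distrib)
qed

end
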